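(* Consider the Auto-Correcting Parabolic Target Following Method (ACPTFM), described in the context, with parameter $r\in(0,1)$ and $\beta=\frac{r}{2+r}$. For $w=(v^{(0)},v)\in\mathcal F_p$ let $\mu^*(w)=\frac{(v^{(0)})^2}{v^{(0)}-\|v\|^2}$ (so that $\mu^*(w)\ge v^{(0)}$). Then for every iteration $k\ge 0$ at which a predictor step is performed, $$\mu^*(w_{k+1})\le\frac{1}{1+\gamma}\,\mu^*(w_k),\qquad \gamma=\frac{1}{1+\sqrt{\tilde n_r/r}},$$ where $\tilde n_r=\frac{n+1}{2}+n_r$ and $n_r=\frac{25}{6}+\frac{n}{1-\beta}=\frac{25}{6}+\left(1+\frac r2\right)n$.
   Context: Let $A\in\mathbb{R}^{m\times n}$ (of full row rank), $b\in\mathbb{R}^m$, $c\in\mathbb{R}^n$ and $\mathcal F_0=\{u=(x,s,y): Ax=b,\ s+A^Ty=c,\ x>0,\ s>0\}$, assumed nonempty (the relative interior of the feasible set of the primal-dual pair $\min\{\langle c,x\rangle: Ax=b,\ x\ge0\}=\max\{\langle b,y\rangle: s+A^Ty=c,\ s\ge0\}$). Notation. Products, powers and square roots of vectors are componentwise; $\|\cdot\|$ is the Euclidean norm; $\check e\in\mathbb{R}^n$ is the vector of ones. Control variables: $w=(v^{(0)},v)\in\mathcal F_p=\{(v^{(0)},v)\in\mathbb{R}_+\times\mathbb{R}^n: v^{(0)}>\|v\|^2\}$, $\rho(w)=\frac{v^{(0)}-\|v\|^2}{n+1}$. For $z=(u,w)$, $u=(x,s,y)$, the residual $r(z)\in\mathbb{R}^{n+1}$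 has components $r^{(0)}(z)=v^{(0)}-\langle s,x\rangle$, $r^{(i)}(z)=x^{(i)}s^{(i)}-(v^{(i)})^2$ for $1\le i\le n$; $\check r(z)\in\mathbb{R}^n$ consists of components $1,\dots,n$. Let $\mathcal F=\{(u,w): u\in\mathcal F_0, w\in\mathcal F_p, r(z)\ge0\}$; its interior is given by $r(z)>0$. On the interior, $F(z)=-\sum_{i=0}^n\ln r^{(i)}(z)$ and $\Psi(z)=F(z)+(n+1)\ln\rho(w)\ge0$ is the functional proximity measure. For $k=0,1,2$ let $\chi_k(z)=\Big[\sum_{i=0}^n\frac{(r^{(i)}(z)-\rho(w))^2}{[r^{(i)}(z)]^k[\rho(w)]^{2-k}}\Big]^{1/2}$ and $\delta(z)=\chi_1^2(z)/\chi_2(z)$ ($\delta(z)=0$ if $\chi_2(z)=0$). For $u_k=(x_k,s_k,y_k)\in\mathcal F_0$ with $X_k=\mathrm{Diag}(x_k)$, $S_k=\mathrm{Diag}(s_k)$ and $d\in\mathbb{R}^n$, $\Delta_k(d)=(\Delta^x,\Delta^s,\Delta^y)$ is the unique solution of $X_k\Delta^s+S_k\Delta^x=d$, $A\Delta^x=0$, $\Delta^s+A^T\Delta^y=0$. Let $\omega_*(\tau)=-\tau-\ln(1-\tau)$, $0\le\tau<1$. Method ACPTFM. Choose $r\in(0,1)$, $A_\psi=\omega_*(r)$, $\beta=\frac{r}{2+r}$, $u_0=(x_0,s_0,y_0)\in\mathcal F_0$. With $\sigma=\min_i x_0^{(i)}s_0^{(i)}$, set $w_0=(v_0^{(0)},v_0)$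 where $v_0^{(0)}=\langle s_0,x_0\rangle+\sigma$, $v_0^{(i)}=\sqrt{x_0^{(i)}s_0^{(i)}-\sigma}$. At iteration $k\ge0$, with $z_k=(u_k,w_k)$, $w_k=(v_k^{(0)},v_k)$: Predictor step (performed if $\delta(z_k)\le\beta$): set $\tilde d_k=\frac{\|v_k\|^2}{n+1}\check e-v_k^2-x_ks_k$, $\tilde\Delta_k=\Delta_k(\tilde d_k)$, take $\alpha_k\in(0,1)$ a solution of $\Psi(u_k+\alpha\tilde\Delta_k,(1-\alpha)w_k)=A_\psi$ (with the point in the interior of $\mathcal F$), and set $u_{k+1}=u_k+\alpha_k\tilde\Delta_k$, $w_{k+1}=(1-\alpha_k)w_k$. Corrector step (otherwise): set $d_k=\rho(w_k)\check e-\check r(z_k)$, $\Delta_k=\Delta_k(d_k)$, take $\alpha_k\ge0$ an approximate minimizer of $F(u_k+\alpha\Delta_k,w_k)$ over $\alpha\ge0$, and set $u_{k+1}=u_k+\alpha_k\Delta_k$, $w_{k+1}=w_k$. Stop if $v_k^{(0)}\le\epsilon$ and $\delta(z_k)\le\beta$. *)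

theory Defs
  imports "HOL-Analysis.Analysis"
begin

type_synonym ('n, 'm) pd_point = "(real ^ 'n) \<times> (real ^ 'n) \<times> (real ^ 'm)"
type_synonym 'n control = "real \<times> (real ^ 'n)"
type_synonym ('n, 'm) state = "('n, 'm) pd_point \<times> 'n control"

definition F0 :: "real ^ 'n ^ 'm \<Rightarrow> real ^ 'm \<Rightarrow> real ^ 'n \<Rightarrow> ('n, 'm) pd_point set" where
  "F0 A b c = {(x, s, y). A *v x = b \<and> s + transpose A *v y = c \<and>
     (\<forall>i. 0 < x $ i) \<and> (\<forall>i. 0 < s $ i)}"

definition Fp :: "('n::finite) control set" where
  "Fp = {(v0, v). 0 \<le> v0 \<and> (norm v)\<^sup>2 < v0}"

definition rho :: "('n::finite) control \<Rightarrow> real" where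
  "rho w = (fst w - (norm (snd w))\<^sup>2) / (real CARD('n) + 1)"

text \<open>The index set of size n + 1 is the type 'n option: None is the index 0, and
  Some i is the component i of an n-vector.\<close>

definition resid :: "('n::finite, 'm) state \<Rightarrow> 'n option \<Rightarrow> real" where
  "resid z j = (case z of ((x, s, y), (v0, v)) \<Rightarrow>
     (case j of None \<Rightarrow> v0 - s \<bullet> x | Some i \<Rightarrow> x $ i * s $ i - (v $ i)\<^sup>2))"

definition Fset :: "real ^ 'n ^ 'm \<Rightarrow> real ^ 'm \<Rightarrow> real ^ 'n \<Rightarrow> ('n, 'm) state set" where
  "Fset A b c = {(u, w). u \<in> F0 A b c \<and> w \<in> Fp \<and> (\<forall>j. 0 \<le> resid (u, w) j)}"

text \<open>The interior is relative to the affine hull given by the equality constraints.\<close>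

definition Fint :: "real ^ 'n ^ 'm \<Rightarrow> real ^ 'm \<Rightarrow> real ^ 'n \<Rightarrow> ('n, 'm) state set" where
  "Fint A b c = {z \<in> Fset A b c. \<forall>j. 0 < resid z j}"

definition barrier :: "('n::finite, 'm) state \<Rightarrow> real" where
  "barrier z = - (\<Sum>j\<in>UNIV. ln (resid z j))"

definition Psi :: "('n::finite, 'm) state \<Rightarrow> real" where
  "Psi z = barrier z + (real CARD('n) + 1) * ln (rho (snd z))"

text \<open>Meant for k = 0, 1, 2 only, so that the natural number subtraction is exact.\<close>

definition chi :: "nat \<Rightarrow> ('n::finite, 'm) state \<Rightarrow> real" where
  "chi k z = sqrt (\<Sum>j\<in>UNIV. (resid z j - rho (snd z))\<^sup>2 /
                               (resid z j ^ k * rho (snd z) ^ (2 - k)))"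

definition prox_delta :: "('n::finite, 'm) state \<Rightarrow> real" where
  "prox_delta z = (if chi 2 z = 0 then 0 else (chi 1 z)\<^sup>2 / chi 2 z)"

definition direction :: "real ^ 'n ^ 'm \<Rightarrow> ('n, 'm) pd_point \<Rightarrow> real ^ 'n \<Rightarrow> ('n, 'm) pd_point" where
  "direction A u d = (case u of (x, s, y) \<Rightarrow>
     (THE (dx, ds, dy). (\<chi> i. x $ i * ds $ i + s $ i * dx $ i) = d \<and>
                        A *v dx = 0 \<and> ds + transpose A *v dy = 0))"

definition omega_star :: "real \<Rightarrow> real" where
  "omega_star \<tau> = - \<tau> - ln (1 - \<tau>)"

definition beta :: "real \<Rightarrow> real" where
  "beta r = r / (2 + r)"

definition initial_control :: "('n::finite, 'm) pd_point \<Rightarrow> 'n control" where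
  "initial_control u0 = (case u0 of (x0, s0, y0) \<Rightarrow>
     let \<sigma> = Min (range (\<lambda>i. x0 $ i * s0 $ i))
     in (s0 \<bullet> x0 + \<sigma>, \<chi> i. sqrt (x0 $ i * s0 $ i - \<sigma>)))"

definition predictor_rhs :: "('n::finite, 'm) state \<Rightarrow> real ^ 'n" where
  "predictor_rhs z = (case z of ((x, s, y), (v0, v)) \<Rightarrow>
     \<chi> i. (norm v)\<^sup>2 / (real CARD('n) + 1) - (v $ i)\<^sup>2 - x $ i * s $ i)"

definition corrector_rhs :: "('n::finite, 'm) state \<Rightarrow> real ^ 'n" where
  "corrector_rhs z = (\<chi> i. rho (snd z) - resid z (Some i))"

definition predictor_point ::
  "real ^ 'n ^ 'm \<Rightarrow> ('n, 'm) state \<Rightarrow> real \<Rightarrow> ('n, 'm) state" where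
  "predictor_point A z \<alpha> =
     (fst z + \<alpha> *\<^sub>R direction A (fst z) (predictor_rhs z), (1 - \<alpha>) *\<^sub>R snd z)"

definition corrector_point ::
  "real ^ 'n ^ 'm \<Rightarrow> ('n, 'm) state \<Rightarrow> real \<Rightarrow> ('n, 'm) state" where
  "corrector_point A z \<alpha> =
     (fst z + \<alpha> *\<^sub>R direction A (fst z) (corrector_rhs z), snd z)"

definition predictor_step ::
  "real ^ 'n ^ 'm \<Rightarrow> real ^ 'm \<Rightarrow> real ^ 'n \<Rightarrow> real \<Rightarrow>
   ('n, 'm) state \<Rightarrow> ('n, 'm) state \<Rightarrow> bool" where
  "predictor_step A b c r z z' \<longleftrightarrow>
     (\<exists>\<alpha>. 0 < \<alpha> \<and> \<alpha> < 1 \<and> predictor_point A z \<alpha> \<in> Fint A b c \<and>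
          Psi (predictor_point A z \<alpha>) = omega_star r \<and> z' = predictor_point A z \<alpha>)"

text \<open>An approximate minimizer is a point whose value exceeds the infimum by at most
  the tolerance \<open>\<eta>\<close>. The minimization runs over the domain of the barrier.\<close>

definition corrector_step ::
  "real ^ 'n ^ 'm \<Rightarrow> real ^ 'm \<Rightarrow> real ^ 'n \<Rightarrow> real \<Rightarrow>
   ('n, 'm) state \<Rightarrow> ('n, 'm) state \<Rightarrow> bool" where
  "corrector_step A b c \<eta> z z' \<longleftrightarrow>
     (\<exists>\<alpha>\<ge>0. corrector_point A z \<alpha> \<in> Fint A b c \<and>
            (\<forall>\<alpha>'\<ge>0. corrector_point A z \<alpha>' \<in> Fint A b c \<longrightarrow>
               barrier (corrector_point A z \<alpha>) \<le> barrier (corrector_point A z \<alpha>') + \<eta>) \<and>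
            z' = corrector_point A z \<alpha>)"

definition acptfm_stop :: "real \<Rightarrow> real \<Rightarrow> ('n::finite, 'm) state \<Rightarrow> bool" where
  "acptfm_stop r \<epsilon> z \<longleftrightarrow> fst (snd z) \<le> \<epsilon> \<and> prox_delta z \<le> beta r"

text \<open>\<open>z 0, \<dots>, z N\<close> are the first iterates of a run in which at least \<open>N\<close> iterations
  (numbers \<open>0, \<dots>, N - 1\<close>) are performed. Iteration \<open>k\<close> uses the tolerance \<open>\<eta> k\<close> if it is
  a corrector step.\<close>

definition acptfm_run ::
  "real ^ 'n ^ 'm \<Rightarrow> real ^ 'm \<Rightarrow> real ^ 'n \<Rightarrow> real \<Rightarrow> real \<Rightarrow> (nat \<Rightarrow> real) \<Rightarrow>
   ('n, 'm) pd_point \<Rightarrow> nat \<Rightarrow> (nat \<Rightarrow> ('n, 'm) state) \<Rightarrow> bool" where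
  "acptfm_run A b c r \<epsilon> \<eta> u0 N z \<longleftrightarrow>
     z 0 = (u0, initial_control u0) \<and>
     (\<forall>k<N. \<not> acptfm_stop r \<epsilon> (z k) \<and>
        (if prox_delta (z k) \<le> beta r
         then predictor_step A b c r (z k) (z (Suc k))
         else corrector_step A b c (\<eta> k) (z k) (z (Suc k))))"

definition mu_star :: "('n::finite) control \<Rightarrow> real" where
  "mu_star w = (fst w)\<^sup>2 / (fst w - (norm (snd w))\<^sup>2)"

definition n_r :: "nat \<Rightarrow> real \<Rightarrow> real" where
  "n_r n r = 25 / 6 + real n / (1 - beta r)"

definition n_tilde :: "nat \<Rightarrow> real \<Rightarrow> real" where
  "n_tilde n r = (real n + 1) / 2 + n_r n r"

definition gamma_rate :: "nat \<Rightarrow> real \<Rightarrow> real" where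
  "gamma_rate n r = 1 / (1 + sqrt (n_tilde n r / r))"

end

theory Submission
  imports Defs
begin

text \<open>
  Write \<open>N = n + 1\<close>, \<open>h = \<parallel>v\<parallel>\<^sup>2 / N\<close>, \<open>R\<close> for the residual vector and \<open>\<rho>\<close> for its mean, so that
  \<open>v0 = N (\<rho> + h)\<close>. For a predictor step of length \<open>\<alpha>\<close> along \<open>(dx, ds, dy)\<close> the new residuals
  and their mean are
  \<open>R' = (1 - \<alpha>) (R + \<alpha> h) + \<alpha>\<^sup>2 P\<close> and \<open>\<rho>' = (1 - \<alpha>) (\<rho> + \<alpha> h)\<close>,
  where \<open>P\<close> has the components \<open>h\<close> and \<open>h + dx i * ds i - (v i)\<^sup>2\<close>, which sum to \<open>0\<close>.

  Closeness \<open>\<delta> \<le> \<beta>\<close> at the old point yields \<open>\<parallel>R - \<rho>\<parallel> \<le> (r/2) \<rho>\<close> and \<open>R i \<ge> (1 - \<beta>) \<rho>\<close>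
  (\<open>centrality_bounds\<close>). The lower bound on \<open>R\<close> and the orthogonality of \<open>dx\<close> and \<open>ds\<close> give
  \<open>\<parallel>P\<parallel> \<le> (K / 2) (h + \<rho>)\<^sup>2 / \<rho>\<close> with \<open>K\<close> the constant \<open>n_tilde\<close>
  (\<open>predictor_correction_bound\<close>). With \<open>T = \<alpha> (\<rho> + h) / ((1 - \<alpha>) \<rho>)\<close>, the relative deviation
  \<open>e = R' / \<rho>' - 1\<close> therefore has norm at most \<open>r/2 + (K/2) T\<^sup>2\<close>. If \<open>T < \<gamma>\<close>, then
  \<open>T\<^sup>2 < r / K\<close>, hence \<open>\<parallel>e\<parallel> < r\<close> and \<open>\<Psi> < \<omega>\<^sub>*(r)\<close> at the new point
  (\<open>neg_sum_ln_less_omega_star\<close>), contrary to the choice of \<open>\<alpha>\<close>. So \<open>T \<ge> \<gamma>\<close>, and this is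
  the claim, because the ratio of the old to the new value of \<open>mu_star\<close> is
  \<open>(\<rho> + \<alpha> h) / ((1 - \<alpha>) \<rho>) = 1 + T\<close>.
\<close>

section \<open>The univariate barrier function\<close>

text \<open>The quotient of \<^const>\<open>omega_star\<close> by the square of its argument is largest at the right end
  of a symmetric interval: compare the power series \<open>\<Sum>k\<ge>2. t ^ k / k\<close> termwise.\<close>

lemma omega_star_quadratic_bound:
  assumes "\<bar>t\<bar> \<le> \<tau>" "\<tau> < 1"
  shows "\<tau>\<^sup>2 * omega_star t \<le> t\<^sup>2 * omega_star \<tau>"
proof -
  \<comment> \<open>The term for \<open>k = 0\<close> is \<open>1 / 0 = 0\<close>, so only \<open>k = 1\<close> has to be removed by hand.\<close>
  have S: "(\<lambda>k. (if k = 1 then 0 else a ^ k / real k)) sums omega_star a"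
    if "\<bar>a\<bar> < 1" for a :: real
  proof -
    have "(\<lambda>k. a ^ k / real k) sums (- ln (1 - a))"
      using sums_minus[OF ln_series'[of "- a"]] that by simp
    moreover have "(\<lambda>k. if k = 1 then a else 0) sums a"
      by (rule sums_single)
    ultimately have "(\<lambda>k. a ^ k / real k - (if k = 1 then a else 0)) sums (- ln (1 - a) - a)"
      by (rule sums_diff)
    moreover have "(\<lambda>k. a ^ k / real k - (if k = 1 then a else 0))
        = (\<lambda>k. if k = 1 then 0 else a ^ k / real k)"
      by auto
    moreover have "- ln (1 - a) - a = omega_star a"
      by (simp add: omega_star_def)
    ultimately show ?thesis by metis
  qed
  have "\<tau>\<^sup>2 * (if k = 1 then 0 else t ^ k / real k)
      \<le> t\<^sup>2 * (if k = 1 then 0 else \<tau> ^ k / real k)" for k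
  proof (cases "k \<le> 1")
    case True
    then show ?thesis by (cases k) auto
  next
    case False
    then obtain m where k: "k = m + 2"
      by (metis add.commute le_Suc_ex not_less_eq_eq numeral_2_eq_2 One_nat_def)
    have "t ^ m \<le> \<tau> ^ m"
      by (metis assms(1) abs_ge_self abs_ge_zero order_trans power_abs power_mono)
    then have "t\<^sup>2 * \<tau>\<^sup>2 * t ^ m / real k \<le> t\<^sup>2 * \<tau>\<^sup>2 * \<tau> ^ m / real k"
      by (intro divide_right_mono mult_left_mono) auto
    moreover have "t ^ k = t\<^sup>2 * t ^ m" "\<tau> ^ k = \<tau>\<^sup>2 * \<tau> ^ m"
      by (simp_all only: k power_add mult.commute)
    ultimately show ?thesis
      using False by (simp add: mult_ac)
  qed
  then show ?thesis
    by (rule sums_le[OF _ sums_mult[OF S] sums_mult[OF S]]) (use assms in auto)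
qed

text \<open>For deviations \<open>e\<close> of zero sum, \<open>- ln (1 + e j)\<close> may be replaced by
  \<open>- ln (1 + e j) + e j = omega_star (- e j)\<close>. This turns a bound on the Euclidean norm of \<open>e\<close> into
  one on the functional proximity measure.\<close>

lemma neg_sum_ln_less_omega_star:
  assumes fin: "finite I" and zero: "(\<Sum>j\<in>I. e j) = 0"
    and e: "L2_set e I < r" and r: "r < 1"
  shows "- (\<Sum>j\<in>I. ln (1 + e j)) < omega_star r"
proof -
  have r0: "0 < r" using e L2_set_nonneg[of e I] by linarith
  have om: "0 < omega_star r"
    using ln_eq_minus_one[of "1 - r"] ln_le_minus_one[of "1 - r"] r r0
    by (force simp: omega_star_def)
  have "r\<^sup>2 * (- (\<Sum>j\<in>I. ln (1 + e j))) = (\<Sum>j\<in>I. r\<^sup>2 * omega_star (- e j))"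
    using zero by (simp add: omega_star_def sum_subtractf sum_distrib_left[symmetric])
  also have "\<dots> \<le> (\<Sum>j\<in>I. (e j)\<^sup>2 * omega_star r)"
  proof (rule sum_mono)
    fix j assume "j \<in> I"
    then have "\<bar>e j\<bar> \<le> L2_set e I"
      using member_le_L2_set[OF fin, of j "\<lambda>j. \<bar>e j\<bar>"] by (simp add: L2_set_def)
    then show "r\<^sup>2 * omega_star (- e j) \<le> (e j)\<^sup>2 * omega_star r"
      using omega_star_quadratic_bound[of "- e j" r] e r by simp
  qed
  also have "\<dots> = (L2_set e I)\<^sup>2 * omega_star r"
    by (simp add: L2_set_def sum_nonneg sum_distrib_right)
  also have "\<dots> < r\<^sup>2 * omega_star r"
    using e om by (intro mult_strict_right_mono power_strict_mono) auto
  finally show ?thesis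
    by (rule mult_left_less_imp_less) simp
qed

section \<open>Consequences of closeness to the target\<close>

text \<open>Let \<open>y = \<rho> / R - 1\<close>, so that \<open>R / \<rho> = 1 / (1 + y)\<close>. The assumption reads
  \<open>\<Sum>j. (y j)\<^sup>2 / (1 + y j) \<le> \<beta> \<parallel>y\<parallel>\<close>. Since \<open>1 + y j \<le> 1 + \<parallel>y\<parallel>\<close>, it follows that
  \<open>\<parallel>y\<parallel> \<le> \<beta> / (1 - \<beta>) = r / 2\<close>, and each \<open>R j / \<rho>\<close> lies between \<open>1 - \<beta>\<close> and \<open>2 / (2 - r)\<close>. The
  second conclusion is a Kantorovich-type reverse of the Cauchy-Schwarz inequality on this
  range.\<close>

lemma centrality_bounds:
  fixes R :: "'a \<Rightarrow> real"
  assumes fin: "finite I" and r: "0 < r" "r < 1"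
    and R: "\<And>j. j \<in> I \<Longrightarrow> 0 < R j" and \<rho>: "0 < \<rho>"
    and close: "(\<Sum>j\<in>I. (R j - \<rho>)\<^sup>2 / (R j * \<rho>)) \<le> beta r * sqrt (\<Sum>j\<in>I. (R j - \<rho>)\<^sup>2 / (R j)\<^sup>2)"
  shows "\<And>j. j \<in> I \<Longrightarrow> (1 - beta r) * \<rho> \<le> R j"
    and "L2_set (\<lambda>j. R j - \<rho>) I \<le> r / 2 * \<rho>"
proof -
  define y where "y = (\<lambda>j. \<rho> / R j - 1)"
  define X where "X = L2_set y I"
  have X0: "0 \<le> X" by (simp add: X_def)
  have X2: "X\<^sup>2 = (\<Sum>j\<in>I. (y j)\<^sup>2)" by (simp add: X_def L2_set_def sum_nonneg)
  have yX: "\<bar>y j\<bar> \<le> X" if "j \<in> I" for j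
    using member_le_L2_set[OF fin that, of "\<lambda>j. \<bar>y j\<bar>"] by (simp add: L2_set_def X_def)
  have Rel: "R j / \<rho> = 1 / (1 + y j)" "0 < 1 + y j" "R j - \<rho> = - y j * R j" if "j \<in> I" for j
    using R[OF that] \<rho> by (auto simp: y_def field_simps)
  have y2: "(R j - \<rho>)\<^sup>2 / (R j)\<^sup>2 = (y j)\<^sup>2" and y1: "(R j - \<rho>)\<^sup>2 / (R j * \<rho>) = (y j)\<^sup>2 * (R j / \<rho>)"
    and y0: "(R j - \<rho>)\<^sup>2 = (y j)\<^sup>2 * (R j / \<rho>)\<^sup>2 * \<rho>\<^sup>2" if "j \<in> I" for j
    using R[OF that] \<rho> Rel(3)[OF that] by (auto simp: power_mult_distrib power_divide power2_eq_square)
  have c: "(\<Sum>j\<in>I. (y j)\<^sup>2 * (R j / \<rho>)) \<le> beta r * X"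
    using close by (simp add: y1 y2 X_def L2_set_def cong: sum.cong)
  have "X\<^sup>2 / (1 + X) = (\<Sum>j\<in>I. (y j)\<^sup>2 * (1 / (1 + X)))"
    by (simp add: X2 sum_divide_distrib)
  also have "\<dots> \<le> (\<Sum>j\<in>I. (y j)\<^sup>2 * (R j / \<rho>))"
    using yX Rel(1,2) by (intro sum_mono mult_left_mono) (auto simp: frac_le abs_le_iff)
  also have "\<dots> \<le> beta r * X"
    by (rule c)
  finally have "X\<^sup>2 \<le> beta r * X * (1 + X)"
    using X0 by (simp add: divide_le_eq)
  then have "X \<le> beta r * (1 + X)" if "X > 0"
    using that by (simp add: power2_eq_square mult_ac)
  then have Xr: "X \<le> r / 2"
    using X0 r by (cases "X = 0") (auto simp: beta_def field_simps)
  have lo: "1 - beta r \<le> R j / \<rho>" and hi: "R j / \<rho> \<le> 2 / (2 - r)" if "j \<in> I" for j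
  proof -
    have "1 + y j \<le> 1 + r / 2" "1 - r / 2 \<le> 1 + y j"
      using yX[OF that] Xr by auto
    then have "1 / (1 + r / 2) \<le> 1 / (1 + y j)" "1 / (1 + y j) \<le> 1 / (1 - r / 2)"
      using Rel(2)[OF that] r by (auto intro!: frac_le)
    then show "1 - beta r \<le> R j / \<rho>" "R j / \<rho> \<le> 2 / (2 - r)"
      using r by (auto simp: Rel(1)[OF that] beta_def field_simps)
  qed
  show "(1 - beta r) * \<rho> \<le> R j" if "j \<in> I" for j
    using lo[OF that] \<rho> by (simp add: field_simps)
  have ab: "1 - beta r + 2 / (2 - r) = 8 / (4 - r\<^sup>2)" "(1 - beta r) * (2 / (2 - r)) = 4 / (4 - r\<^sup>2)"
  proof -
    have "4 - r\<^sup>2 = (2 + r) * (2 - r)" by (simp add: power2_eq_square algebra_simps)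
    then show "1 - beta r + 2 / (2 - r) = 8 / (4 - r\<^sup>2)" "(1 - beta r) * (2 / (2 - r)) = 4 / (4 - r\<^sup>2)"
      using r by (simp_all add: beta_def divide_simps) (simp add: algebra_simps)?
  qed
  have r4: "0 < 4 - r\<^sup>2" using r power_strict_mono[of r 2 2] by simp
  have "(\<Sum>j\<in>I. (y j)\<^sup>2 * (R j / \<rho>)\<^sup>2)
      \<le> (\<Sum>j\<in>I. 8 / (4 - r\<^sup>2) * ((y j)\<^sup>2 * (R j / \<rho>)) - 4 / (4 - r\<^sup>2) * (y j)\<^sup>2)"
  proof (rule sum_mono)
    fix j assume j: "j \<in> I"
    \<comment> \<open>The point \<open>R j / \<rho>\<close> lies between the ends of the interval.\<close>
    have "0 \<le> (R j / \<rho> - (1 - beta r)) * (2 / (2 - r) - R j / \<rho>)"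
      using lo[OF j] hi[OF j] by simp
    also have "(u - a) * (b - u) = (a + b) * u - a * b - u\<^sup>2" for u a b :: real
      by (simp add: power2_eq_square algebra_simps)
    also note ab(1)
    also note ab(2)
    finally have "(R j / \<rho>)\<^sup>2 \<le> 8 / (4 - r\<^sup>2) * (R j / \<rho>) - 4 / (4 - r\<^sup>2)" by simp
    from mult_left_mono[OF this, of "(y j)\<^sup>2"]
    show "(y j)\<^sup>2 * (R j / \<rho>)\<^sup>2 \<le> 8 / (4 - r\<^sup>2) * ((y j)\<^sup>2 * (R j / \<rho>)) - 4 / (4 - r\<^sup>2) * (y j)\<^sup>2"
      by (simp add: right_diff_distrib mult_ac)
  qed
  also have "\<dots> = 8 / (4 - r\<^sup>2) * (\<Sum>j\<in>I. (y j)\<^sup>2 * (R j / \<rho>)) - 4 / (4 - r\<^sup>2) * X\<^sup>2"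
    by (simp only: sum_subtractf sum_distrib_left X2)
  also have "\<dots> \<le> 8 / (4 - r\<^sup>2) * (beta r * X) - 4 / (4 - r\<^sup>2) * X\<^sup>2"
    using c r4 by (intro diff_right_mono mult_left_mono) auto
  also have "\<dots> = 4 / (4 - r\<^sup>2) * ((beta r)\<^sup>2 - (beta r - X)\<^sup>2)"
  proof -
    have "8 * q * (b * X) - 4 * q * X\<^sup>2 = 4 * q * (b\<^sup>2 - (b - X)\<^sup>2)" for q b :: real
      by (simp add: power2_eq_square algebra_simps)
    from this[of "1 / (4 - r\<^sup>2)"] show ?thesis by simp
  qed
  also have "\<dots> \<le> 4 / (4 - r\<^sup>2) * (beta r)\<^sup>2"
    using r4 by (intro mult_left_mono) auto
  also have "\<dots> \<le> (r / 2)\<^sup>2"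
  proof -
    have "0 \<le> r * (16 - 4 * r\<^sup>2 - r ^ 3)"
      using r power_le_one[of r 2] power_le_one[of r 3] by (intro mult_nonneg_nonneg) auto
    then have "16 \<le> (4 - r\<^sup>2) * (2 + r)\<^sup>2"
      by (simp add: power2_eq_square power3_eq_cube algebra_simps)
    then have "r\<^sup>2 * 16 \<le> r\<^sup>2 * ((4 - r\<^sup>2) * (2 + r)\<^sup>2)"
      by (rule mult_left_mono) auto
    then show ?thesis
      using r r4 by (simp add: beta_def power_divide divide_simps mult_ac)
  qed
  finally have "(\<Sum>j\<in>I. (y j)\<^sup>2 * (R j / \<rho>)\<^sup>2) * \<rho>\<^sup>2 \<le> (r / 2)\<^sup>2 * \<rho>\<^sup>2"
    by (rule mult_right_mono) auto
  then have "(\<Sum>j\<in>I. (R j - \<rho>)\<^sup>2) \<le> (r / 2 * \<rho>)\<^sup>2"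
    by (simp add: y0 sum_distrib_right power_mult_distrib[of "r / 2"] del: times_divide_eq_left cong: sum.cong)
  then show "L2_set (\<lambda>j. R j - \<rho>) I \<le> r / 2 * \<rho>"
    unfolding L2_set_def using r \<rho> by (intro real_le_lsqrt) (auto simp: sum_nonneg)
qed

section \<open>The scaled Newton system\<close>

text \<open>Eliminating \<open>ds = - A\<^sup>T dy\<close> leaves a square linear system in \<open>(dx, dy)\<close>. A solution of the
  homogeneous system satisfies \<open>\<Sum>i. (s i / x i) (dx i)\<^sup>2 = dx \<bullet> A\<^sup>T dy = 0\<close>, hence vanishes by full
  row rank. So the system has exactly one solution, and the definite description in
  \<^const>\<open>direction\<close> is meaningful.\<close>

lemma direction_properties:
  fixes A :: "real ^ 'n ^ 'm" and x s :: "real ^ 'n"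
  assumes rank: "rank A = CARD('m)" and x: "\<And>i. 0 < x $ i" and s: "\<And>i. 0 < s $ i"
  obtains dx ds dy where "direction A (x, s, y) d = (dx, ds, dy)"
    and "\<And>i. x $ i * ds $ i + s $ i * dx $ i = d $ i"
    and "dx \<bullet> ds = 0"
proof -
  define L :: "(real ^ 'n) \<times> (real ^ 'm) \<Rightarrow> (real ^ 'n) \<times> (real ^ 'm)" where
    "L = (\<lambda>(dx, dy). ((\<chi> i. s $ i * dx $ i - x $ i * (transpose A *v dy) $ i), A *v dx))"
  have lin: "linear L"
    by (rule linearI)
      (auto simp: L_def vec_eq_iff matrix_vector_right_distrib matrix_vector_mult_scaleR algebra_simps
        simp del: transpose_matrix_vector)
  have injT: "inj ((*v) (transpose A))"
    unfolding full_rank_injective[symmetric] rank_transpose by (rule rank)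
  have orth: "dx \<bullet> (transpose A *v dy) = 0" if "A *v dx = 0" for dx dy
    using that by (metis dot_lmul_matrix inner_commute inner_zero_left transpose_transpose vector_transpose_matrix)
  have "p = 0" if "L p = 0" for p
  proof -
    obtain dx dy where p: "p = (dx, dy)" by (cases p)
    have 1: "s $ i * dx $ i = x $ i * (transpose A *v dy) $ i" for i
      using that by (auto simp: L_def p zero_prod_def vec_eq_iff)
    have 2: "A *v dx = 0"
      using that by (auto simp: L_def p zero_prod_def)
    have "(\<Sum>i\<in>UNIV. s $ i / x $ i * (dx $ i)\<^sup>2) = dx \<bullet> (transpose A *v dy)"
      unfolding inner_vec_def
    proof (rule sum.cong)
      fix i
      show "s $ i / x $ i * (dx $ i)\<^sup>2 = dx $ i \<bullet> (transpose A *v dy) $ i"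
        using 1[of i] x[of i] by (simp add: field_simps power2_eq_square)
    qed simp
    then have "(\<Sum>i\<in>UNIV. s $ i / x $ i * (dx $ i)\<^sup>2) = 0"
      using orth[OF 2] by simp
    then have "\<forall>i\<in>UNIV. s $ i / x $ i * (dx $ i)\<^sup>2 = 0"
      using x s by (subst (asm) sum_nonneg_eq_0_iff) (auto simp: less_imp_le)
    then have dx: "dx = 0"
      using x s by (auto simp: vec_eq_iff less_le)
    then have "transpose A *v dy = transpose A *v 0"
      using 1 x by (auto simp: vec_eq_iff less_le)
    then have "dy = 0" using injT by (metis injD)
    then show ?thesis by (simp add: p dx zero_prod_def)
  qed
  then have inj: "inj L" using lin linear_injective_0 by blast
  then have "surj L" using lin linear_injective_imp_surjective by blast
  then obtain dx dy where L: "L (dx, dy) = (d, 0)" by (metis surjD surj_pair)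
  define ds where "ds = - (transpose A *v dy)"
  have eq: "x $ i * ds $ i + s $ i * dx $ i = d $ i" for i
    using L by (auto simp: L_def ds_def)
  have A: "A *v dx = 0" using L by (simp add: L_def)
  have uniq: "(a, b, g) = (dx, ds, dy)"
    if "(\<chi> i. x $ i * b $ i + s $ i * a $ i) = d" "A *v a = 0" "b + transpose A *v g = 0"
    for a b g
  proof -
    have b: "b = - (transpose A *v g)" using that(3) by (simp add: eq_neg_iff_add_eq_0)
    have "L (a, g) = (d, 0)" using that(1,2) by (auto simp: L_def b vec_eq_iff)
    then have "(a, g) = (dx, dy)" using inj L by (metis injD)
    then show ?thesis by (simp add: b ds_def)
  qed
  have "direction A (x, s, y) d = (dx, ds, dy)"
    unfolding direction_def prod.case
  proof (rule the_equality)
    show "case (dx, ds, dy) of (dx, ds, dy) \<Rightarrow>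
        (\<chi> i. x $ i * ds $ i + s $ i * dx $ i) = d \<and> A *v dx = 0 \<and> ds + transpose A *v dy = 0"
      using eq A by (auto simp: vec_eq_iff ds_def)
  qed (use uniq in blast)
  moreover have "dx \<bullet> ds = 0" using orth[OF A] by (simp add: ds_def)
  ultimately show ?thesis using that eq by blast
qed

section \<open>The residuals\<close>

lemma sum_UNIV_option:
  fixes f :: "'n::finite option \<Rightarrow> real"
  shows "(\<Sum>j\<in>UNIV. f j) = f None + (\<Sum>i\<in>UNIV. f (Some i))"
  by (simp add: UNIV_option_conv sum.reindex o_def)

lemma norm_power2_vec: "(norm (v :: real ^ 'n))\<^sup>2 = (\<Sum>i\<in>UNIV. (v $ i)\<^sup>2)"
  unfolding power2_norm_eq_inner inner_vec_def by (simp add: power2_eq_square)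

lemma sum_resid:
  fixes z :: "('n::finite, 'm) state"
  shows "(\<Sum>j\<in>UNIV. resid z j) = (real CARD('n) + 1) * rho (snd z)"
proof -
  obtain x s y v0 v where z: "z = ((x, s, y), (v0, v))" by (metis surj_pair)
  show ?thesis
    unfolding z sum_UNIV_option
    by (simp add: resid_def rho_def sum_subtractf norm_power2_vec inner_vec_def mult.commute)
qed

text \<open>The vector bounded here is the second-order part of the predictor residuals. It is split into
  \<open>h - V\<close> with \<open>V = (0, v\<^sup>2)\<close> and the complementarity products \<open>p = dx * ds\<close>. The former is \<open>V\<close>
  centred up to sign, so its norm is at most \<open>\<parallel>V\<parallel> \<le> \<parallel>v\<parallel>\<^sup>2 = N h\<close>. For the latter,
  \<open>2 \<bar>p i\<bar> + 2 p i \<le> d i ^ 2 / (x i * s i)\<close>, where \<open>d\<close> is the right-hand side of the Newton system;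
  since \<open>p\<close> sums to \<open>0\<close>, the 1-norm of \<open>p\<close> is at most half the sum of these
  quotients.\<close>

lemma predictor_correction_bound:
  fixes x s v dx ds :: "real ^ 'n"
  defines "N \<equiv> real CARD('n) + 1"
  defines "h \<equiv> (norm v)\<^sup>2 / N"
  assumes x: "\<And>i. 0 < x $ i" and s: "\<And>i. 0 < s $ i" and \<rho>: "0 < \<rho>" and c: "1 \<le> c"
    and central: "\<And>i. \<rho> \<le> c * (x $ i * s $ i - (v $ i)\<^sup>2)"
    and gap: "s \<bullet> x \<le> (norm v)\<^sup>2 + N * \<rho>"
    and dir: "\<And>i. x $ i * ds $ i + s $ i * dx $ i = h - (v $ i)\<^sup>2 - x $ i * s $ i"
    and orth: "dx \<bullet> ds = 0"
  shows "L2_set (\<lambda>j. h + (case j of None \<Rightarrow> 0 | Some i \<Rightarrow> dx $ i * ds $ i - (v $ i)\<^sup>2)) UNIV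
      \<le> (N / 4 + (c * real CARD('n) + 4 / 3) / 2) * ((h + \<rho>)\<^sup>2 / \<rho>)"
proof -
  define p where "p = (\<lambda>i. dx $ i * ds $ i)"
  define X where "X = (\<lambda>i. x $ i * s $ i)"
  define V where "V = (\<lambda>i. (v $ i)\<^sup>2)"
  define n where "n = real CARD('n)"
  have N: "N = n + 1" "0 < N" "1 \<le> n" by (simp_all add: N_def n_def)
  have h: "0 \<le> h" "(\<Sum>i\<in>UNIV. V i) = N * h"
    using N(2) by (simp_all add: h_def V_def norm_power2_vec[symmetric])
  have X0: "0 < X i" for i using x s by (simp add: X_def)
  have V0: "0 \<le> V i" for i by (simp add: V_def)
  have VX: "V i < X i" "\<rho> \<le> c * X i" for i
  proof -
    have "0 < c * (X i - V i)" using central[of i] \<rho> by (simp add: X_def V_def)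
    then show "V i < X i" using c by (simp add: zero_less_mult_iff)
    have "c * (X i - V i) \<le> c * X i" using c V0 by simp
    then show "\<rho> \<le> c * X i" using central[of i] by (simp add: X_def V_def)
  qed
  have p0: "(\<Sum>i\<in>UNIV. p i) = 0" using orth by (simp add: p_def inner_vec_def)
  have rhs: "(h - V i - X i)\<^sup>2 / X i \<le> h\<^sup>2 * c / \<rho> - 2 * h + 3 * V i + X i" for i
  proof -
    have "(h - V i - X i)\<^sup>2 / X i = h\<^sup>2 / X i - 2 * h + 2 * V i + X i + V i * (V i / X i) - 2 * (h * V i / X i)"
      using X0[of i] by (simp add: field_simps power2_eq_square)
    moreover have "h\<^sup>2 / X i \<le> h\<^sup>2 * c / \<rho>"
    proof -
      have "h\<^sup>2 * \<rho> \<le> h\<^sup>2 * (c * X i)" by (rule mult_left_mono) (use VX in auto)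
      then show ?thesis using X0[of i] \<rho> by (simp add: field_simps)
    qed
    moreover have "V i * (V i / X i) \<le> V i * 1"
      using VX[of i] V0[of i] X0[of i] by (intro mult_left_mono) auto
    moreover have "0 \<le> h * V i / X i" using h V0[of i] X0[of i] by simp
    ultimately show ?thesis by linarith
  qed
  have p_le: "\<bar>p i\<bar> \<le> (h - V i - X i)\<^sup>2 / X i / 2 - p i" for i
  proof -
    \<comment> \<open>Complete the square with the two summands of the Newton equation.\<close>
    define a b where "a = x $ i * ds $ i" and "b = s $ i * dx $ i"
    have ab: "a * b = X i * p i" by (simp add: a_def b_def X_def p_def)
    have "h - V i - X i = a + b" using dir[of i] by (simp add: V_def X_def a_def b_def)
    then have "(h - V i - X i)\<^sup>2 = a\<^sup>2 + b\<^sup>2 + 2 * (X i * p i)"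
      by (simp add: power2_sum ab)
    moreover have "2 * (X i * \<bar>p i\<bar>) \<le> a\<^sup>2 + b\<^sup>2"
      using sum_squares_bound[of "\<bar>a\<bar>" "\<bar>b\<bar>"] X0[of i] ab
      by (metis abs_mult abs_of_pos mult.assoc power2_abs)
    ultimately have "2 * (X i * \<bar>p i\<bar>) + 2 * (X i * p i) \<le> (h - V i - X i)\<^sup>2" by linarith
    then show ?thesis using X0[of i] by (simp add: field_simps)
  qed
  have "(\<Sum>i\<in>UNIV. \<bar>p i\<bar>) \<le> (\<Sum>i\<in>UNIV. (h\<^sup>2 * c / \<rho> - 2 * h + 3 * V i + X i) / 2 - p i)"
    by (intro sum_mono order_trans[OF p_le]) (use rhs in \<open>simp add: divide_right_mono\<close>)
  also have "\<dots> = (n * (h\<^sup>2 * c / \<rho> - 2 * h) + 3 * (N * h) + s \<bullet> x) / 2"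
  proof -
    have "(\<Sum>i\<in>UNIV. X i) = s \<bullet> x" by (simp add: X_def inner_vec_def mult.commute)
    then show ?thesis
      unfolding sum_subtractf sum_divide_distrib[symmetric] sum.distrib sum_distrib_left[symmetric] p0 h(2)
      by (simp add: n_def algebra_simps)
  qed
  also have "\<dots> \<le> (n * (h\<^sup>2 * c / \<rho> - 2 * h) + 4 * (N * h) + N * \<rho>) / 2"
    using gap N by (simp add: h_def)
  also have "\<dots> = (n * c * (h\<^sup>2 / \<rho>) + n * (2 * h + \<rho>) + (4 * h + \<rho>)) / 2"
    by (simp add: N algebra_simps)
  also have "\<dots> \<le> (n * c * (h\<^sup>2 / \<rho>) + n * c * (2 * h + \<rho>) + 4 / 3 * ((h + \<rho>)\<^sup>2 / \<rho>)) / 2"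
  proof -
    have "n * 1 * (2 * h + \<rho>) \<le> n * c * (2 * h + \<rho>)"
      using c N h \<rho> by (intro mult_right_mono mult_left_mono) auto
    moreover have "4 * h + \<rho> \<le> 4 / 3 * ((h + \<rho>)\<^sup>2 / \<rho>)"
    proof -
      have "0 \<le> (2 * h - \<rho>)\<^sup>2" by simp
      then show ?thesis using \<rho> by (simp add: field_simps power2_eq_square)
    qed
    ultimately show ?thesis by simp
  qed
  also have "\<dots> = (c * n + 4 / 3) / 2 * ((h + \<rho>)\<^sup>2 / \<rho>)"
    using \<rho> by (simp add: field_simps power2_eq_square)
  finally have p_sum: "(\<Sum>i\<in>UNIV. \<bar>p i\<bar>) \<le> (c * n + 4 / 3) / 2 * ((h + \<rho>)\<^sup>2 / \<rho>)" .
  have "L2_set (\<lambda>j. case j of None \<Rightarrow> 0 | Some i \<Rightarrow> p i) UNIV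
      \<le> (\<Sum>j\<in>UNIV. \<bar>case j of None \<Rightarrow> 0 | Some i \<Rightarrow> p i\<bar>)"
    by (rule L2_set_le_sum_abs)
  also have "\<dots> = (\<Sum>i\<in>UNIV. \<bar>p i\<bar>)"
    by (simp add: sum_UNIV_option)
  also note p_sum
  finally have part1: "L2_set (\<lambda>j. case j of None \<Rightarrow> 0 | Some i \<Rightarrow> p i) UNIV
      \<le> (c * n + 4 / 3) / 2 * ((h + \<rho>)\<^sup>2 / \<rho>)" .
  have "(\<Sum>j\<in>UNIV. (h - (case j of None \<Rightarrow> 0 | Some i \<Rightarrow> V i))\<^sup>2)
      = h\<^sup>2 + (\<Sum>i\<in>UNIV. h\<^sup>2 - 2 * h * V i + (V i)\<^sup>2)"
    by (simp add: sum_UNIV_option power2_diff algebra_simps)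
  also have "\<dots> = N * h\<^sup>2 - 2 * h * (N * h) + (\<Sum>i\<in>UNIV. (V i)\<^sup>2)"
    unfolding sum.distrib sum_subtractf sum_distrib_left[symmetric] h(2)
    by (simp add: N(1) n_def algebra_simps)
  also have "\<dots> \<le> (\<Sum>i\<in>UNIV. (V i)\<^sup>2)"
    using mult_nonneg_nonneg[of N "h\<^sup>2"] N(2) by (simp add: power2_eq_square)
  also have "\<dots> \<le> (\<Sum>i\<in>UNIV. V i)\<^sup>2"
    using V0 L2_set_le_sum[of UNIV V] by (simp add: L2_set_def sum_nonneg real_sqrt_le_iff' real_le_rsqrt sqrt_le_D)
  finally have part2: "L2_set (\<lambda>j. h - (case j of None \<Rightarrow> 0 | Some i \<Rightarrow> V i)) UNIV \<le> N * h"
    using h N by (simp add: L2_set_def real_le_lsqrt sum_nonneg)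
  have Nh: "N * h \<le> N / 4 * ((h + \<rho>)\<^sup>2 / \<rho>)"
  proof -
    have "4 * h * \<rho> \<le> (h + \<rho>)\<^sup>2"
      using sum_squares_bound[of h \<rho>] unfolding power2_sum by linarith
    then have "h \<le> (h + \<rho>)\<^sup>2 / \<rho> / 4" using \<rho> by (simp add: field_simps)
    from mult_left_mono[OF this, of N] show ?thesis using N by simp
  qed
  have split: "(\<lambda>j. h + (case j of None \<Rightarrow> 0 | Some i \<Rightarrow> dx $ i * ds $ i - (v $ i)\<^sup>2))
     = (\<lambda>j. (h - (case j of None \<Rightarrow> 0 | Some i \<Rightarrow> V i)) + (case j of None \<Rightarrow> 0 | Some i \<Rightarrow> p i))"
    by (auto simp: V_def p_def fun_eq_iff split: option.split)
  show ?thesis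
    unfolding split n_def[symmetric] distrib_right
    by (rule order_trans[OF L2_set_triangle_ineq add_mono[OF order_trans[OF part2 Nh] part1]])
qed

text \<open>The form of \<open>\<delta> \<le> \<beta>\<close> without quotient, which covers the case \<open>\<chi>\<^sub>2 = 0\<close>.\<close>

lemma prox_delta_leD:
  assumes "prox_delta z \<le> \<beta>" and R: "\<And>j. 0 < resid z j" and \<rho>: "0 < rho (snd z)"
  shows "(\<Sum>j\<in>UNIV. (resid z j - rho (snd z))\<^sup>2 / (resid z j * rho (snd z)))
      \<le> \<beta> * sqrt (\<Sum>j\<in>UNIV. (resid z j - rho (snd z))\<^sup>2 / (resid z j)\<^sup>2)"
proof -
  have 1: "(chi 1 z)\<^sup>2 = (\<Sum>j\<in>UNIV. (resid z j - rho (snd z))\<^sup>2 / (resid z j * rho (snd z)))"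
    using R \<rho> by (simp add: chi_def sum_nonneg less_imp_le)
  have 2: "chi 2 z = sqrt (\<Sum>j\<in>UNIV. (resid z j - rho (snd z))\<^sup>2 / (resid z j)\<^sup>2)"
    by (simp add: chi_def)
  show ?thesis
  proof (cases "chi 2 z = 0")
    case True
    then have "\<forall>j\<in>UNIV. (resid z j - rho (snd z))\<^sup>2 / (resid z j)\<^sup>2 = 0"
      unfolding 2 by (subst sum_nonneg_eq_0_iff[symmetric]) auto
    then have "resid z j = rho (snd z)" for j
      using R[of j] by auto
    then show ?thesis by simp
  next
    case False
    moreover have "0 \<le> chi 2 z" unfolding 2 by (simp add: sum_nonneg)
    ultimately have "0 < chi 2 z" by simp
    then have "(chi 1 z)\<^sup>2 \<le> \<beta> * chi 2 z"
      using assms(1) by (simp add: prox_delta_def divide_le_eq)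
    then show ?thesis by (simp only: 1 2)
  qed
qed

lemma FintD:
  assumes "((x, s, y), (v0, v)) \<in> Fint A b c"
  shows "\<And>i. 0 < x $ i" "\<And>i. 0 < s $ i" "(norm v)\<^sup>2 < v0"
    and "\<And>j. 0 < resid ((x, s, y), (v0, v)) j"
  using assms by (auto simp: Fint_def Fset_def F0_def Fp_def)

section \<open>Decrease along a predictor step\<close>

lemma predictor_step_mu_star:
  fixes A :: "real ^ 'n ^ 'm"
  assumes rank: "rank A = CARD('m)" and r: "0 < r" "r < 1"
    and z: "z \<in> Fint A b c" and \<delta>: "prox_delta z \<le> beta r"
    and step: "predictor_step A b c r z z'"
  shows "mu_star (snd z') \<le> 1 / (1 + gamma_rate CARD('n) r) * mu_star (snd z)"
proof -
  obtain x s y v0 v where zeq: "z = ((x, s, y), (v0, v))" by (metis surj_pair)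
  note F = FintD[OF z[unfolded zeq]]
  obtain \<alpha> where \<alpha>: "0 < \<alpha>" "\<alpha> < 1" and z': "z' = predictor_point A z \<alpha>" "z' \<in> Fint A b c"
    and \<Psi>: "Psi z' = omega_star r"
    using step by (auto simp: predictor_step_def)
  define N where "N = real CARD('n) + 1"
  define h where "h = (norm v)\<^sup>2 / N"
  define \<rho> where "\<rho> = rho (v0, v)"
  define R where "R = resid z"
  define c' where "c' = 1 / (1 - beta r)"
  define \<gamma> where "\<gamma> = gamma_rate CARD('n) r"
  define K where "K = n_tilde CARD('n) r"
  have N: "1 \<le> N" by (simp add: N_def)
  have h0: "0 \<le> h" and Nh: "(norm v)\<^sup>2 = N * h" using N by (simp_all add: h_def)
  have N\<rho>: "v0 - (norm v)\<^sup>2 = N * \<rho>" using N by (simp add: \<rho>_def rho_def N_def)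
  have \<rho>0: "0 < \<rho>" unfolding \<rho>_def rho_def using F(3) by simp
  have b1: "0 < beta r" "beta r < 1" using r by (auto simp: beta_def)
  have R0: "0 < R j" for j using F(4) by (simp add: R_def zeq)

  have "(\<Sum>j\<in>UNIV. (R j - \<rho>)\<^sup>2 / (R j * \<rho>)) \<le> beta r * sqrt (\<Sum>j\<in>UNIV. (R j - \<rho>)\<^sup>2 / (R j)\<^sup>2)"
    using prox_delta_leD[OF \<delta>] R0 \<rho>0 by (simp add: R_def \<rho>_def zeq)
  note central = centrality_bounds[OF finite r R0 \<rho>0 this]
  have R_lower: "\<rho> \<le> c' * R j" for j
    using central(1)[of j] b1 by (simp add: c'_def field_simps)

  obtain dx ds dy where dir: "direction A (x, s, y) (predictor_rhs z) = (dx, ds, dy)"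
    and eq: "\<And>i. x $ i * ds $ i + s $ i * dx $ i = predictor_rhs z $ i" and orth: "dx \<bullet> ds = 0"
    using direction_properties[OF rank F(1,2)] by metis
  have eq: "x $ i * ds $ i + s $ i * dx $ i = h - (v $ i)\<^sup>2 - x $ i * s $ i" for i
    using eq[of i] by (simp add: predictor_rhs_def zeq h_def N_def)
  have z'eq: "z' = ((x + \<alpha> *\<^sub>R dx, s + \<alpha> *\<^sub>R ds, y + \<alpha> *\<^sub>R dy), ((1 - \<alpha>) * v0, (1 - \<alpha>) *\<^sub>R v))"
    using dir by (simp add: z'(1) predictor_point_def zeq)

  define P where "P = (\<lambda>j. h + (case j of None \<Rightarrow> 0 | Some i \<Rightarrow> dx $ i * ds $ i - (v $ i)\<^sup>2))"
  have K: "K = N / 2 + 25 / 6 + c' * real CARD('n)"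
    by (simp add: K_def n_tilde_def n_r_def N_def c'_def)
  have c'1: "1 \<le> c'" using b1 by (simp add: c'_def)
  have K0: "0 < K" using N c'1 by (simp add: K add_pos_nonneg)
  have "s \<bullet> x \<le> v0" using F(4)[of None] by (simp add: resid_def)
  then have "L2_set P UNIV \<le> (N / 4 + (c' * real CARD('n) + 4 / 3) / 2) * ((h + \<rho>)\<^sup>2 / \<rho>)"
    unfolding P_def h_def N_def using R_lower[of "Some _"] N\<rho> eq F(1,2) \<rho>0 c'1 orth
    by (intro predictor_correction_bound[where x = x and s = s]) (auto simp: R_def zeq resid_def h_def N_def)
  also have "\<dots> \<le> K / 2 * ((h + \<rho>)\<^sup>2 / \<rho>)"
    using \<rho>0 by (intro mult_right_mono) (auto simp: K)
  finally have P: "L2_set P UNIV \<le> K / 2 * ((h + \<rho>)\<^sup>2 / \<rho>)" .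

  define D where "D = \<rho> + \<alpha> * h"
  have D0: "0 < D" and D\<rho>: "\<rho> \<le> D" using \<rho>0 \<alpha> h0 by (auto simp: D_def add_pos_nonneg)
  have norm': "(norm ((1 - \<alpha>) *\<^sub>R v))\<^sup>2 = (1 - \<alpha>)\<^sup>2 * (N * h)"
    by (simp add: power_mult_distrib Nh)
  have gap': "(1 - \<alpha>) * v0 - (norm ((1 - \<alpha>) *\<^sub>R v))\<^sup>2 = (1 - \<alpha>) * (N * D)"
  proof -
    have v0: "v0 = N * \<rho> + N * h" using N\<rho> Nh by simp
    show ?thesis unfolding norm' v0 by (simp add: D_def power2_eq_square algebra_simps)
  qed
  have \<rho>': "rho (snd z') = (1 - \<alpha>) * D"
    using gap' N by (simp add: z'eq rho_def N_def del: norm_scaleR)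
  have R': "resid z' j = (1 - \<alpha>) * (R j + \<alpha> * h) + \<alpha>\<^sup>2 * P j" for j
  proof (cases j)
    case None
    have "(\<Sum>i\<in>UNIV. x $ i * ds $ i + s $ i * dx $ i) = (\<Sum>i\<in>UNIV. h - (v $ i)\<^sup>2 - x $ i * s $ i)"
      by (simp add: eq)
    also have "\<dots> = - h - s \<bullet> x"
      unfolding sum_subtractf norm_power2_vec[symmetric] Nh
      by (simp add: N_def inner_vec_def mult.commute algebra_simps)
    finally have "ds \<bullet> x + s \<bullet> dx = - h - s \<bullet> x"
      by (simp add: sum.distrib inner_vec_def mult.commute)
    moreover have "(s + \<alpha> *\<^sub>R ds) \<bullet> (x + \<alpha> *\<^sub>R dx) = s \<bullet> x + \<alpha> * (ds \<bullet> x + s \<bullet> dx)"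
      using orth by (simp add: inner_simps inner_commute algebra_simps)
    ultimately have "(s + \<alpha> *\<^sub>R ds) \<bullet> (x + \<alpha> *\<^sub>R dx) = s \<bullet> x + \<alpha> * (- h - s \<bullet> x)" by simp
    then show ?thesis
      by (simp add: None z'eq zeq R_def P_def resid_def power2_eq_square algebra_simps)
  next
    case (Some i)
    have "(x $ i + \<alpha> * dx $ i) * (s $ i + \<alpha> * ds $ i)
        = x $ i * s $ i + \<alpha> * (x $ i * ds $ i + s $ i * dx $ i) + \<alpha>\<^sup>2 * (dx $ i * ds $ i)"
      by (simp add: power2_eq_square algebra_simps)
    then have "(x $ i + \<alpha> * dx $ i) * (s $ i + \<alpha> * ds $ i)
        = x $ i * s $ i + \<alpha> * (h - (v $ i)\<^sup>2 - x $ i * s $ i) + \<alpha>\<^sup>2 * (dx $ i * ds $ i)"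
      by (simp only: eq)
    then show ?thesis
      by (simp add: Some z'eq zeq R_def P_def resid_def power2_eq_square algebra_simps)
  qed

  define e where "e = (\<lambda>j. resid z' j / rho (snd z') - 1)"
  define T where "T = \<alpha> * (\<rho> + h) / ((1 - \<alpha>) * \<rho>)"
  have T0: "0 \<le> T" using \<alpha> \<rho>0 h0 by (simp add: T_def)
  \<comment> \<open>First-order and second-order parts of the relative deviation from the mean.\<close>
  have e_split: "e j = (1 / D) * (R j - \<rho>) + \<alpha>\<^sup>2 / ((1 - \<alpha>) * D) * P j" for j
    using \<alpha> D0 unfolding e_def R' \<rho>' by (simp add: field_simps) (simp add: D_def algebra_simps)
  have e_norm: "L2_set e UNIV \<le> r / 2 + K / 2 * T\<^sup>2"
  proof -
    have "L2_set e UNIV \<le> (1 / D) * L2_set (\<lambda>j. R j - \<rho>) UNIV + \<alpha>\<^sup>2 / ((1 - \<alpha>) * D) * L2_set P UNIV"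
      unfolding e_split using L2_set_triangle_ineq[of "\<lambda>j. (1 / D) * (R j - \<rho>)"
        "\<lambda>j. \<alpha>\<^sup>2 / ((1 - \<alpha>) * D) * P j" UNIV] \<alpha> D0
      by (subst (1 2) L2_set_right_distrib) auto
    also have "(1 / D) * L2_set (\<lambda>j. R j - \<rho>) UNIV \<le> (1 / D) * (r / 2 * D)"
      using D0 r
      by (intro mult_left_mono order_trans[OF central(2) mult_left_mono[OF D\<rho>]]) auto
    also have "\<alpha>\<^sup>2 / ((1 - \<alpha>) * D) * L2_set P UNIV
        \<le> \<alpha>\<^sup>2 / ((1 - \<alpha>) * D) * (K / 2 * ((h + \<rho>)\<^sup>2 / \<rho>))"
      using P \<alpha> D0 by (intro mult_left_mono) auto
    also have "\<dots> = K / 2 * T\<^sup>2 * ((1 - \<alpha>) * \<rho> / D)"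
    proof -
      have "\<alpha>\<^sup>2 / (B * D) * (K / 2 * (S\<^sup>2 / \<rho>)) = K / 2 * (\<alpha> * S / (B * \<rho>))\<^sup>2 * (B * \<rho> / D)"
        if "B \<noteq> 0" for B S
        using that \<rho>0 D0 by (simp add: field_simps power2_eq_square)
      from this[of "1 - \<alpha>" "\<rho> + h"] show ?thesis
        using \<alpha> by (simp add: T_def add.commute)
    qed
    also have "\<dots> \<le> K / 2 * T\<^sup>2 * 1"
    proof (intro mult_left_mono)
      have "(1 - \<alpha>) * \<rho> \<le> D" using \<alpha> \<rho>0 D\<rho> mult_left_le_one_le[of \<rho> "1 - \<alpha>"] by linarith
      then show "(1 - \<alpha>) * \<rho> / D \<le> 1" using D0 by simp
    qed (use K0 in auto)
    finally show ?thesis using D0 by simp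
  qed
  have \<gamma>_def': "\<gamma> = 1 / (1 + sqrt (K / r))" by (simp add: \<gamma>_def gamma_rate_def K_def)
  have \<gamma>0: "0 < \<gamma>" using K0 r by (simp add: \<gamma>_def' add_pos_pos)
  have "\<gamma> \<le> T"
  proof (rule ccontr)
    assume "\<not> \<gamma> \<le> T"
    then have "T\<^sup>2 < \<gamma>\<^sup>2" using T0 by (intro power_strict_mono) auto
    also have "\<dots> \<le> (1 / sqrt (K / r))\<^sup>2"
      unfolding \<gamma>_def' using K0 r by (intro power_mono frac_le) (auto simp: add_pos_pos)
    also have "\<dots> = r / K" using K0 r by (simp add: power_divide)
    finally have "K / 2 * T\<^sup>2 < r / 2" using K0 by (simp add: field_simps)
    then have small: "L2_set e UNIV < r" using e_norm by simp
    have R'0: "0 < resid z' j" for j using z'(2) by (auto simp: Fint_def)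
    have \<rho>'0: "0 < rho (snd z')" unfolding \<rho>' using \<alpha> D0 by simp
    have "(\<Sum>j\<in>UNIV. e j) = 0"
      using \<rho>'0 by (simp add: e_def sum_subtractf sum_divide_distrib[symmetric] sum_resid card_UNIV_option)
    from neg_sum_ln_less_omega_star[OF finite this small r(2)]
    have "- (\<Sum>j\<in>UNIV. ln (resid z' j / rho (snd z'))) < omega_star r"
      by (simp add: e_def)
    also have "- (\<Sum>j\<in>UNIV. ln (resid z' j / rho (snd z'))) = Psi z'"
      using R'0 \<rho>'0
      by (simp add: ln_divide_pos Psi_def barrier_def sum_subtractf card_UNIV_option algebra_simps)
    finally show False using \<Psi> by simp
  qed
  then have "\<gamma> * ((1 - \<alpha>) * \<rho>) \<le> \<alpha> * (\<rho> + h)"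
    using \<alpha> \<rho>0 by (simp add: T_def pos_le_divide_eq)
  then have key: "(1 + \<gamma>) * ((1 - \<alpha>) * \<rho>) \<le> D" by (simp add: D_def algebra_simps)
  have "mu_star (snd z') = ((1 - \<alpha>) * v0)\<^sup>2 / ((1 - \<alpha>) * (N * D))"
    unfolding mu_star_def z'eq using gap' by (simp del: norm_scaleR)
  also have "\<dots> = v0\<^sup>2 / N * ((1 - \<alpha>) / D)"
    using \<alpha> N D0 by (simp add: field_simps power2_eq_square)
  also have "\<dots> \<le> v0\<^sup>2 / N * (1 / ((1 + \<gamma>) * \<rho>))"
  proof (intro mult_left_mono)
    have "(1 - \<alpha>) * Q \<le> D \<Longrightarrow> (1 - \<alpha>) / D \<le> 1 / Q" if "0 < Q" for Q
      using that D0 by (simp add: field_simps)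
    from this[of "(1 + \<gamma>) * \<rho>"] show "(1 - \<alpha>) / D \<le> 1 / ((1 + \<gamma>) * \<rho>)"
      using key \<gamma>0 \<rho>0 by (simp add: mult_ac)
  qed (use N in simp)
  also have "\<dots> = 1 / (1 + \<gamma>) * mu_star (snd z)"
    by (simp add: mu_star_def zeq N\<rho>)
  finally show ?thesis by (simp add: \<gamma>_def)
qed

section \<open>Runs of the method\<close>

text \<open>The initial control makes all residuals equal to \<open>\<sigma>\<close>.\<close>

lemma initial_control_interior:
  fixes u0 :: "('n::finite, 'm::finite) pd_point"
  assumes "u0 \<in> F0 A b c"
  shows "(u0, initial_control u0) \<in> Fint A b c"
proof -
  obtain x s y where u0: "u0 = (x, s, y)" by (metis surj_pair)
  have pos: "\<And>i. 0 < x $ i" "\<And>i. 0 < s $ i" using assms by (auto simp: u0 F0_def)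
  define \<sigma> where "\<sigma> = Min (range (\<lambda>i. x $ i * s $ i))"
  define v :: "real ^ 'n" where "v = (\<chi> i. sqrt (x $ i * s $ i - \<sigma>))"
  have \<sigma>0: "0 < \<sigma>" unfolding \<sigma>_def using pos by (subst Min_gr_iff) auto
  have "\<sigma> \<le> x $ i * s $ i" for i unfolding \<sigma>_def by (rule Min_le) auto
  then have v: "(v $ i)\<^sup>2 = x $ i * s $ i - \<sigma>" for i by (simp add: v_def)
  have w: "initial_control u0 = (s \<bullet> x + \<sigma>, v)"
    by (simp add: initial_control_def u0 \<sigma>_def v_def Let_def)
  have res: "resid (u0, initial_control u0) j = \<sigma>" for j
    by (cases j) (simp_all add: resid_def u0 w[unfolded u0] v)
  have "(norm v)\<^sup>2 = s \<bullet> x - real CARD('n) * \<sigma>"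
    by (simp add: norm_power2_vec v sum_subtractf inner_vec_def mult.commute)
  moreover have "0 \<le> s \<bullet> x" unfolding inner_vec_def using pos by (simp add: sum_nonneg less_imp_le)
  moreover have "0 \<le> real CARD('n) * \<sigma>" using \<sigma>0 by simp
  ultimately have "initial_control u0 \<in> Fp" unfolding w Fp_def case_prod_conv mem_Collect_eq using \<sigma>0 by linarith
  then show ?thesis using assms res \<sigma>0 by (simp add: Fint_def Fset_def)
qed

lemma acptfm_run_interior:
  assumes start: "u0 \<in> F0 A b c" and run: "acptfm_run A b c r \<epsilon> \<eta> u0 N z" and "k \<le> N"
  shows "z k \<in> Fint A b c"
  using \<open>k \<le> N\<close>
proof (cases k)
  case 0
  then show ?thesis using run initial_control_interior[OF start] by (simp add: acptfm_run_def)
next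
  case (Suc l)
  then have "if prox_delta (z l) \<le> beta r then predictor_step A b c r (z l) (z k)
      else corrector_step A b c (\<eta> l) (z l) (z k)"
    using run \<open>k \<le> N\<close> unfolding acptfm_run_def by auto
  then show ?thesis by (auto simp: predictor_step_def corrector_step_def split: if_splits)
qed

theorem mainTheorem9:
  fixes A :: "real ^ 'n ^ 'm" and b :: "real ^ 'm" and c :: "real ^ 'n"
    and r \<epsilon> :: real and \<eta> :: "nat \<Rightarrow> real"
    and u0 :: "('n, 'm) pd_point" and N :: nat and z :: "nat \<Rightarrow> ('n, 'm) state"
  assumes full_row_rank: "rank A = CARD('m)"
    and r_range: "0 < r" "r < 1"
    and accuracy: "0 < \<epsilon>"
    and tolerances: "\<And>k. 0 \<le> \<eta> k"
    and start: "u0 \<in> F0 A b c"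
    and run: "acptfm_run A b c r \<epsilon> \<eta> u0 N z"
  shows "(\<forall>w \<in> (Fp :: 'n control set). fst w \<le> mu_star w) \<and>
         n_r CARD('n) r = 25 / 6 + (1 + r / 2) * real CARD('n) \<and>
         (\<forall>k<N. prox_delta (z k) \<le> beta r \<longrightarrow>
            mu_star (snd (z (Suc k)))
              \<le> 1 / (1 + gamma_rate CARD('n) r) * mu_star (snd (z k)))"
proof (intro conjI ballI allI impI)
  fix w :: "'n control" assume "w \<in> Fp"
  then have w: "0 \<le> fst w" "(norm (snd w))\<^sup>2 < fst w" by (auto simp: Fp_def)
  have "fst w * (fst w - (norm (snd w))\<^sup>2) \<le> fst w * fst w"
    using w by (intro mult_left_mono) auto
  then show "fst w \<le> mu_star w"
    using w by (simp add: mu_star_def pos_le_divide_eq power2_eq_square)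
next
  show "n_r CARD('n) r = 25 / 6 + (1 + r / 2) * real CARD('n)"
    using r_range by (simp add: n_r_def beta_def field_simps)
next
  fix k assume k: "k < N" and \<delta>: "prox_delta (z k) \<le> beta r"
  then have "predictor_step A b c r (z k) (z (Suc k))"
    using run by (auto simp: acptfm_run_def)
  with k \<delta> show "mu_star (snd (z (Suc k))) \<le> 1 / (1 + gamma_rate CARD('n) r) * mu_star (snd (z k))"
    using predictor_step_mu_star[OF full_row_rank r_range acptfm_run_interior[OF start run]] by simp
qed

end
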